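(* Let $H$ be an oriented graph of order $N$, and put $d=\delta^0(H)$. If $d\ge3$ and $7d\ge2N+3$, then for every ordered pair $(x,y)$ of distinct vertices of $H$ there is a directed path from $x$ to $y$ in $H$ of length $3$, $4$, or $5$.
   Context: An oriented graph is an orientation of a (finite) simple graph: no loops, and at most one arc on each unordered pair of vertices. $\delta^0(H)=\min_{v}\min\{d^+(v),d^-(v)\}$ is the minimum semidegree. Paths are directed and simple (no repeated vertices), and the length is the number of arcs. *)

theory Defs
  imports "Graph_Theory.Graph_Theory"
begin

text \<open>
  The locale \<^locale>\<open>digraph\<close> already provides finiteness and excludes loops and parallel arcs;
  what remains is to exclude pairs of opposite arcs.
\<close>

locale oriented_graph = digraph +
  assumes no_opposite_arcs: "u \<rightarrow> v \<Longrightarrow> \<not> v \<rightarrow> u"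

text \<open>Unspecified when there are no vertices.\<close>

definition min_semidegree :: "('a, 'b) pre_digraph \<Rightarrow> nat" where
  "min_semidegree G = Min ((\<lambda>v. min (out_degree G v) (in_degree G v)) ` verts G)"

end

theory Submission
  imports Defs
begin

text \<open>
  Let A be the set of out-neighbours of x other than y, B the set of in-neighbours of y other than x,
  S the new out-neighbours of A and T the new in-neighbours of B. Without paths of length 3 or 4
  there are no arcs from A or S to B and none from A to T, so S and T are disjoint; without paths of
  length 5 an arc from S to T can only close a triangle through a vertex of the intersection of A and B.
  The out-degrees of the vertices of M, the union of A - B and S, sum to at least d times |M|. At most
  |M| (|M| - 1) / 2 arcs stay inside M, and all arcs leaving M start in S and end in x, in T or
  outside A, B, S, T and {x, y}. So if M is not too large then many vertices lie outside, and together
  with lower bounds on |M| and on its counterpart for B and T this forces 2 N > 7 d - 3.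
\<close>

section \<open>Degree sums over a vertex set\<close>

text \<open>Each pair of vertices carries at most one arc: in the induction, the out- and
  in-neighbours of the new vertex in \<open>M\<close> are disjoint, so at most \<open>card M\<close>
  arcs are added.\<close>

lemma asym_sum_card_le:
  assumes "finite M" and asym: "\<And>u v. E u v \<Longrightarrow> \<not> E v u"
  shows "2 * (\<Sum>v\<in>M. card {w\<in>M. E v w}) \<le> card M * (card M - 1)"
  using \<open>finite M\<close>
proof (induction M)
  case empty
  show ?case by simp
next
  case (insert v M)
  have "{w\<in>insert v M. E u w} = {w\<in>M. E u w} \<union> (if E u v then {v} else {})" for u
    by auto
  then have "card {w\<in>insert v M. E u w} = card {w\<in>M. E u w} + (if E u v then 1 else 0)" for u
    using insert.hyps by (auto simp: card_insert_if)
  moreover have "\<not> E v v"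
    using asym by blast
  moreover have "(\<Sum>u\<in>M. if E u v then 1 else 0) = card {u\<in>M. E u v}"
    using insert.hyps by (simp add: sum.If_cases Collect_conj_eq)
  ultimately have "(\<Sum>u\<in>insert v M. card {w\<in>insert v M. E u w})
      = card {w\<in>M. E v w} + ((\<Sum>u\<in>M. card {w\<in>M. E u w}) + card {u\<in>M. E u v})"
    using insert.hyps by (simp add: sum.distrib del: insert_iff)
  moreover have "card {w\<in>M. E v w} + card {u\<in>M. E u v} = card ({w\<in>M. E v w} \<union> {u\<in>M. E u v})"
    using insert.hyps asym by (subst card_Un_disjoint) auto
  moreover have "\<dots> \<le> card M"
    using insert.hyps by (intro card_mono) auto
  ultimately have "2 * (\<Sum>u\<in>insert v M. card {w\<in>insert v M. E u w})
      \<le> card M * (card M - 1) + 2 * card M"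
    using insert.IH by linarith
  also have "\<dots> = card (insert v M) * (card (insert v M) - 1)"
    using insert.hyps by (cases "card M") auto
  finally show ?case .
qed

text \<open>The arcs from each vertex split into those staying in \<open>M\<close>, counted by
  \<open>asym_sum_card_le\<close>, and at most \<open>k\<close> others, the latter only from
  \<open>S\<close>. It is applied to \<open>E\<close> and to its converse, also with
  \<open>S = M\<close>.\<close>

lemma degree_sum_le:
  assumes fin: "finite M" and asym: "\<And>u v. E u v \<Longrightarrow> \<not> E v u" and "S \<subseteq> M"
    and deg: "\<And>v. v \<in> M \<Longrightarrow> d \<le> card {w. E v w}"
    and leave: "\<And>v. v \<in> S \<Longrightarrow> card ({w. E v w} - M) \<le> k"
    and stay: "\<And>v. v \<in> M - S \<Longrightarrow> {w. E v w} \<subseteq> M"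
  shows "2 * d * card M \<le> card M * (card M - 1) + 2 * k * card S"
proof -
  have "d \<le> card {w\<in>M. E v w} + (if v \<in> S then k else 0)" if "v \<in> M" for v
  proof -
    have "{w. E v w} = {w\<in>M. E v w} \<union> ({w. E v w} - M)"
      by auto
    then have "card {w. E v w} \<le> card {w\<in>M. E v w} + card ({w. E v w} - M)"
      using card_Un_le by metis
    moreover have "card ({w. E v w} - M) \<le> (if v \<in> S then k else 0)"
      using leave[of v] stay[of v] that by (auto simp: Diff_eq_empty_iff[THEN iffD2])
    ultimately show ?thesis
      using deg[OF that] by linarith
  qed
  then have "(\<Sum>v\<in>M. d) \<le> (\<Sum>v\<in>M. card {w\<in>M. E v w} + (if v \<in> S then k else 0))"
    by (rule sum_mono)
  also have "\<dots> = (\<Sum>v\<in>M. card {w\<in>M. E v w}) + k * card S"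
    using fin \<open>S \<subseteq> M\<close> by (simp add: sum.distrib sum.If_cases Int_absorb1)
  finally have "2 * (d * card M) \<le> 2 * (\<Sum>v\<in>M. card {w\<in>M. E v w}) + 2 * (k * card S)"
    by (simp add: mult.commute)
  also have "2 * (\<Sum>v\<in>M. card {w\<in>M. E v w}) \<le> card M * (card M - 1)"
    using fin asym by (rule asym_sum_card_le)
  finally show ?thesis
    by (simp add: mult.assoc)
qed

section \<open>Numerical contradictions\<close>

text \<open>
  In the next two lemmas z is the number of common vertices of A and B, m = |A - B| + |S|,
  m' = |B - A| + |T|, s = |S|, w is the number of vertices outside A, B, S, T and {x, y}, and k bounds
  the number of arcs from a vertex of S to T. Equality is almost attained for z = m = m' = d - 1.
\<close>

lemma few_common_contradiction:
  fixes d N z m m' w s k a :: real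
  assumes "a = d - 1 - z" "0 \<le> z" "1 \<le> a" "0 \<le> w" "0 \<le> k"
    and "2 * d + a + 1 \<le> 2 * m" "2 * d + a + 1 + 2 * k \<le> 2 * m'"
    and "s \<le> m - a"
    and deg: "2 * d * m \<le> m * (m - 1) + 2 * (w + 1 + k) * s"
    and "N = 2 + m + z + m' + w" "2 * N + 3 \<le> 7 * d"
  shows False
proof -
  \<comment> \<open>\<open>x\<close> is the excess of \<open>m\<close> over its lower bound
    \<open>d + h\<close>. In these parameters the difference of the two sides of the degree
    inequality becomes a visibly positive sum.\<close>
  define h x where "h = (a + 1) / 2" and "x = m - d - h"
  have d: "d = 2 * h + z" and m: "m = d + h + x" and "h \<ge> 1" "x \<ge> 0"
    using assms by (auto simp: h_def x_def field_simps)
  \<comment> \<open>The bound on \<open>N\<close> together with the lower bound on \<open>m'\<close>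
    limits \<open>w + k\<close>; the terms in \<open>h\<close> cancel.\<close>
  have "2 * (w + 1 + k) \<le> d - 5 - 2 * x" "s \<le> d + 1 - h + x"
    using assms by (auto simp: h_def x_def field_simps)
  moreover have "0 \<le> d + 1 - h + x"
    using d \<open>h \<ge> 1\<close> \<open>x \<ge> 0\<close> \<open>0 \<le> z\<close> by simp
  ultimately have "2 * (w + 1 + k) * s \<le> (d - 5 - 2 * x) * (d + 1 - h + x)"
    using \<open>0 \<le> w\<close> \<open>0 \<le> k\<close>
    by (meson mult_left_mono mult_right_mono order_trans add_nonneg_nonneg zero_le_one
        mult_nonneg_nonneg zero_le_numeral)
  then have "m * (2 * d - m + 1) \<le> (d - 5 - 2 * x) * (d + 1 - h + x)"
    using deg by (simp add: algebra_simps)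
  moreover have "m * (2 * d - m + 1) - (d - 5 - 2 * x) * (d + 1 - h + x)
      = (h - x)\<^sup>2 + 6 * h + 5 + z * (h + 5) + x * (z + 8)"
    unfolding m d by (simp add: algebra_simps power2_eq_square)
  moreover have "0 < (h - x)\<^sup>2 + 6 * h + 5 + z * (h + 5) + x * (z + 8)"
    using \<open>h \<ge> 1\<close> \<open>x \<ge> 0\<close> \<open>0 \<le> z\<close> by (intro add_pos_nonneg add_nonneg_pos) auto
  ultimately show False
    by linarith
qed

lemma many_common_contradiction:
  fixes d N z m m' w s k :: real
  assumes "d - 1 \<le> z" "1 < d" "0 \<le> w" "0 \<le> k"
    and "d - 1 \<le> m" "d - 1 + k \<le> m'"
    and "s \<le> m"
    and deg: "2 * d * m \<le> m * (m - 1) + 2 * (w + 1 + k) * s"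
    and "N = 2 + m + z + m' + w" "2 * N + 3 \<le> 7 * d"
  shows False
proof -
  \<comment> \<open>Here \<open>s \<le> m\<close> is good enough, and the factor
    \<open>m > 0\<close> can be cancelled.\<close>
  have "2 * (w + 1 + k) * s \<le> 2 * (w + 1 + k) * m"
    using assms by (intro mult_left_mono) auto
  then have "m * (2 * d) \<le> m * (m - 1 + 2 * (w + 1 + k))"
    using deg by (simp add: algebra_simps)
  then have "2 * d \<le> m - 1 + 2 * (w + 1 + k)"
    using assms by (simp add: mult_le_cancel_left)
  then show False
    using assms(1,5,6) assms(9,10) by simp
qed

section \<open>The combinatorial argument\<close>

text \<open>Working with a bare relation makes in-degrees the out-degrees of the converse. Lists of
  4, 5, 6 vertices are paths with 3, 4, 5 arcs.\<close>

lemma short_path_of_semidegree: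
  fixes E :: "'a \<Rightarrow> 'a \<Rightarrow> bool"
  assumes fin: "finite V" and E_V: "\<And>u v. E u v \<Longrightarrow> u \<in> V \<and> v \<in> V"
    and asym: "\<And>u v. E u v \<Longrightarrow> \<not> E v u"
    and out_deg: "\<And>v. v \<in> V \<Longrightarrow> d \<le> card {w. E v w}"
    and in_deg: "\<And>v. v \<in> V \<Longrightarrow> d \<le> card {u. E u v}"
    and "3 \<le> d" and large: "2 * card V + 3 \<le> 7 * d"
    and "x \<in> V" "y \<in> V" "x \<noteq> y"
  shows "\<exists>P. length P \<in> {4, 5, 6} \<and> distinct P \<and> hd P = x \<and> last P = y \<and> successively E P"
proof (rule ccontr)
  assume no_path: "\<not> ?thesis"
  have no3: False if "E x a" "E a b" "E b y" "distinct [x, a, b, y]" for a b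
    using no_path that by (auto dest!: spec[of _ "[x, a, b, y]"])
  have no4: False if "E x a" "E a c" "E c b" "E b y" "distinct [x, a, c, b, y]" for a b c
    using no_path that by (auto dest!: spec[of _ "[x, a, c, b, y]"])
  have no5: False if "E x a" "E a c" "E c e" "E e b" "E b y" "distinct [x, a, c, e, b, y]" for a b c e
    using no_path that by (auto dest!: spec[of _ "[x, a, c, e, b, y]"])
  have irrefl: "\<not> E v v" for v
    using asym by blast

  define A B where "A = {a. E x a} - {y}" and "B = {b. E b y} - {x}"
  define A1 B1 Z where "A1 = A - B" and "B1 = B - A" and "Z = A \<inter> B"
  define S T where "S = {c. \<exists>a\<in>A. E a c} - A - {y}" and "T = {e. \<exists>b\<in>B. E e b} - B - {x}"
  define W where "W = V - ({x, y} \<union> A1 \<union> Z \<union> B1 \<union> S \<union> T)"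
  have notin: "x \<notin> A" "y \<notin> A" "x \<notin> B" "y \<notin> B" "x \<notin> S" "y \<notin> S" "x \<notin> T" "y \<notin> T"
    using asym by (auto simp: A_def B_def S_def T_def dest: asym)
  have AB: "\<not> E a b" if "a \<in> A" "b \<in> B" for a b
  proof
    assume "E a b"
    then have "distinct [x, a, b, y]"
      using that notin \<open>x \<noteq> y\<close> irrefl by auto
    with no3[of a b] that \<open>E a b\<close> show False
      by (auto simp: A_def B_def)
  qed
  \<comment> \<open>Such a \<open>c\<close> would itself lie in \<open>B\<close> and be the head of
    an arc from \<open>A\<close>.\<close>
  have Sy: "\<not> E c y" if "c \<in> S" for c
    using that AB notin unfolding B_def S_def by blast
  have SB: "\<not> E c b" if "c \<in> S" "b \<in> B" for b c
  proof
    assume "E c b"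
    from that obtain a where a: "a \<in> A" "E a c"
      by (auto simp: S_def)
    have "distinct [x, a, c, b, y]"
      using that a \<open>E c b\<close> notin \<open>x \<noteq> y\<close> irrefl asym[of a c] by auto
    with no4[of a c b] a that \<open>E c b\<close> show False
      by (auto simp: A_def B_def)
  qed
  have ST: "a = b" if "c \<in> S" "e \<in> T" "E c e" "a \<in> A" "E a c" "b \<in> B" "E e b" for a b c e
  proof (rule ccontr)
    assume "a \<noteq> b"
    have "distinct [x, a, c, e, b, y]"
      using that notin \<open>x \<noteq> y\<close> \<open>a \<noteq> b\<close> irrefl asym[of a c] asym[of c e] SB by auto
    with no5[of a c e b] that show False
      by (auto simp: A_def B_def)
  qed
  \<comment> \<open>Vertices of \<open>S\<close> are heads of arcs from \<open>A\<close>, those of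
    \<open>T\<close> tails of arcs into \<open>B\<close>; a common element would violate
    \<open>AB\<close> or \<open>SB\<close>.\<close>
  have "S \<inter> B = {}" "A \<inter> T = {}"
    using AB unfolding S_def T_def by blast+
  moreover have "S \<inter> T = {}"
    using SB unfolding T_def by blast
  moreover have "A \<inter> S = {}" "B \<inter> T = {}"
    unfolding S_def T_def by blast+
  ultimately have disj: "A1 \<inter> Z = {}" "A1 \<inter> B1 = {}" "Z \<inter> B1 = {}" "A1 \<inter> S = {}" "Z \<inter> S = {}"
      "B1 \<inter> T = {}" "Z \<inter> T = {}" "B1 \<inter> S = {}" "A1 \<inter> T = {}" "S \<inter> T = {}"
    unfolding A1_def B1_def Z_def by blast+
  have sub: "A \<subseteq> V" "B \<subseteq> V" "S \<subseteq> V" "T \<subseteq> V"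
    using E_V by (auto simp: A_def B_def S_def T_def)
  then have fins: "finite A" "finite B" "finite S" "finite T"
    using fin by (auto intro: finite_subset)
  then have fins': "finite A1" "finite B1" "finite Z" "finite W"
    using fin by (auto simp: A1_def B1_def Z_def W_def)

  \<comment> \<open>Partition of the vertex set and the sizes of its classes\<close>
  have disj_W: "(A1 \<union> Z \<union> B1 \<union> S \<union> T) \<inter> W = {}" "x \<notin> W" "y \<notin> W"
    by (auto simp: W_def)
  have "V = insert x (insert y (A1 \<union> Z \<union> B1 \<union> S \<union> T \<union> W))"
    using sub \<open>x \<in> V\<close> \<open>y \<in> V\<close> unfolding W_def A1_def B1_def Z_def by blast
  also have "card \<dots> = 2 + card (A1 \<union> Z \<union> B1 \<union> S \<union> T \<union> W)"
    using fins fins' notin disj_W \<open>x \<noteq> y\<close>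
    by (simp add: A1_def B1_def Z_def)
  also have "card (A1 \<union> Z \<union> B1 \<union> S \<union> T \<union> W) = card (A1 \<union> Z \<union> B1 \<union> S \<union> T) + card W"
    using fins fins' disj_W by (intro card_Un_disjoint) auto
  also have "card (A1 \<union> Z \<union> B1 \<union> S \<union> T) = card A1 + card Z + card B1 + card S + card T"
    using fins fins' disj by (simp add: card_Un_disjoint Int_Un_distrib2)
  finally have card_V: "card V = 2 + card A1 + card Z + card B1 + card S + card T + card W"
    by simp

  \<comment> \<open>One is lost because \<open>y\<close> may be an out-neighbour of
    \<open>x\<close>.\<close>
  have card_A: "d - 1 \<le> card A1 + card Z"
  proof -
    have "card {w. E x w} \<le> card (insert y A)"
      using fins by (intro card_mono) (auto simp: A_def)
    moreover have "card A = card A1 + card Z"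
      using fins' disj by (subst card_Un_disjoint[symmetric]) (auto simp: A1_def Z_def intro: arg_cong[of _ _ card])
    ultimately show ?thesis
      using out_deg[OF \<open>x \<in> V\<close>] fins notin by simp
  qed
  have card_B: "d - 1 \<le> card B1 + card Z"
  proof -
    have "card {w. E w y} \<le> card (insert x B)"
      using fins by (intro card_mono) (auto simp: B_def)
    moreover have "card B = card B1 + card Z"
      using fins' disj by (subst card_Un_disjoint[symmetric]) (auto simp: B1_def Z_def intro: arg_cong[of _ _ card])
    ultimately show ?thesis
      using in_deg[OF \<open>y \<in> V\<close>] fins notin by simp
  qed

  have "A \<noteq> {}"
    using card_A \<open>3 \<le> d\<close> by (auto simp: A1_def Z_def)
  txt \<open>
    F is the set of out-neighbours in T of a vertex c of S having the most of them, and z an in-neighbour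
    of c in A. As all arcs from F to B end in z, the vertices of B other than z have to find their
    in-neighbours without F, so exceptional arcs from S to T are paid for by a larger T.
  \<close>
  obtain F z where F: "F \<subseteq> T" "\<And>c. c \<in> S \<Longrightarrow> card ({e. E c e} \<inter> T) \<le> card F"
    and z: "z \<in> A" "\<And>e b. e \<in> F \<Longrightarrow> b \<in> B \<Longrightarrow> E e b \<Longrightarrow> b = z"
  proof (cases "S = {}")
    \<comment> \<open>Without \<open>S\<close> there are no arcs to account for: \<open>F\<close> is
      empty and \<open>z\<close> is an arbitrary vertex of \<open>A\<close>.\<close>
    case True
    then show ?thesis
      using that[of "{}"] \<open>A \<noteq> {}\<close> by auto
  next
    case False
    let ?f = "\<lambda>c. card ({e. E c e} \<inter> T)"
    have "Max (?f ` S) \<in> ?f ` S"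
      using fins False by (intro Max_in) auto
    then obtain c where c: "c \<in> S" "Max (?f ` S) = ?f c"
      by blast
    then have max: "?f c' \<le> ?f c" if "c' \<in> S" for c'
      using fins Max_ge[of "?f ` S" "?f c'"] that by simp
    from c(1) obtain a where "a \<in> A" "E a c"
      by (auto simp: S_def)
    then show ?thesis
      using that[of "{e. E c e} \<inter> T" a] c max ST by blast
  qed
  have card_TF: "card (T - F) + card F = card T"
    using F(1) fins by (metis card_Diff_subset card_mono finite_subset le_add_diff_inverse2)

  have S_leave: "card ({w. E c w} - (A1 \<union> S)) \<le> card W + 1 + card F" if "c \<in> S" for c
  proof -
    \<comment> \<open>Arcs from \<open>S\<close> to \<open>y\<close> and to \<open>B\<close>, hence
      to \<open>Z\<close>, are excluded; the extra 1 in the bound is for \<open>x\<close>.\<close>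
    have "{w. E c w} - (A1 \<union> S) \<subseteq> insert x W \<union> ({e. E c e} \<inter> T)"
      using E_V Sy[OF that] SB[OF that] by (auto simp: W_def A1_def B1_def Z_def)
    then have "card ({w. E c w} - (A1 \<union> S)) \<le> card (insert x W \<union> ({e. E c e} \<inter> T))"
      using fins fins' by (intro card_mono) auto
    also have "\<dots> \<le> card (insert x W) + card ({e. E c e} \<inter> T)"
      by (rule card_Un_le)
    also have "\<dots> \<le> card W + 1 + card F"
      using F(2)[OF that] fins' by (simp add: card_insert_if)
    finally show ?thesis .
  qed
  have A1_out: "{w. E a w} \<subseteq> A1 \<union> S" if "a \<in> A1" for a
  proof
    fix w assume w: "w \<in> {w. E a w}"
    then have "w \<noteq> y"
      using that notin by (auto simp: A1_def B_def)
    moreover have "w \<notin> B"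
      using that w AB by (auto simp: A1_def)
    ultimately show "w \<in> A1 \<union> S"
      using that w by (auto simp: A1_def S_def)
  qed
  have B1_in: "{u. E u b} \<subseteq> B1 \<union> (T - F)" if "b \<in> B1" for b
  proof
    fix u assume u: "u \<in> {u. E u b}"
    then have "u \<noteq> x"
      using that notin by (auto simp: B1_def A_def)
    moreover have "u \<notin> A"
      using that u AB by (auto simp: B1_def)
    \<comment> \<open>Arcs from \<open>F\<close> into \<open>B\<close> end in \<open>z\<close>,
      which lies in \<open>A\<close> and so outside \<open>B1\<close>.\<close>
    moreover have "u \<notin> F"
      using that u z by (auto simp: B1_def)
    ultimately show "u \<in> B1 \<union> (T - F)"
      using that u by (auto simp: B1_def T_def)
  qed

  \<comment> \<open>Degree inequalities for the two sides\<close>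
  define m m' where "m = card A1 + card S" and "m' = card B1 + card T"
  have deg: "2 * d * m \<le> m * (m - 1) + 2 * (card W + 1 + card F) * card S"
  proof -
    have "card (A1 \<union> S) = m"
      using fins fins' disj by (simp add: m_def card_Un_disjoint)
    moreover have "2 * d * card (A1 \<union> S)
        \<le> card (A1 \<union> S) * (card (A1 \<union> S) - 1) + 2 * (card W + 1 + card F) * card S"
    proof (rule degree_sum_le[where E = E])
      show "d \<le> card {w. E v w}" if "v \<in> A1 \<union> S" for v
        using that sub by (intro out_deg) (auto simp: A1_def)
    qed (use fins fins' asym S_leave A1_out in blast)+
    ultimately show ?thesis
      by simp
  qed
  \<comment> \<open>Every arc leaving \<open>A1\<close> ends in \<open>S\<close>, so the degree sum
    over \<open>A1\<close> alone, divided by \<open>card A1\<close>, bounds \<open>card S\<close>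
    from below.\<close>
  have A1_deg: "2 * d + card A1 + 1 \<le> 2 * m" if "A1 \<noteq> {}"
  proof -
    have "card ({w. E v w} - A1) \<le> card S" if "v \<in> A1" for v
      using A1_out[OF that] fins by (intro card_mono) auto
    then have "2 * d * card A1 \<le> card A1 * (card A1 - 1) + 2 * card S * card A1"
      using fins' asym out_deg sub by (intro degree_sum_le[where E = E]) (auto simp: A1_def)
    then have "card A1 * (2 * d) \<le> card A1 * (card A1 - 1 + 2 * card S)"
      by (simp add: algebra_simps)
    moreover have "0 < card A1"
      using that fins' by (simp add: card_gt_0_iff)
    ultimately show ?thesis
      by (simp add: m_def)
  qed
  \<comment> \<open>The same for the converse relation, with \<open>T - F\<close> in the role of
    \<open>S\<close>; this is where \<open>m'\<close> gains \<open>card F\<close>.\<close>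
  have B1_deg: "2 * d + card B1 + 1 + 2 * card F \<le> 2 * m'" if "B1 \<noteq> {}"
  proof -
    have "card ({u. E u v} - B1) \<le> card (T - F)" if "v \<in> B1" for v
      using B1_in[OF that] fins by (intro card_mono) auto
    then have "2 * d * card B1 \<le> card B1 * (card B1 - 1) + 2 * card (T - F) * card B1"
      using fins' asym in_deg sub
      by (intro degree_sum_le[where E = "\<lambda>u v. E v u"]) (auto simp: B1_def)
    then have "card B1 * (2 * d) \<le> card B1 * (card B1 - 1 + 2 * card (T - F))"
      by (simp add: algebra_simps)
    moreover have "0 < card B1"
      using that fins' by (simp add: card_gt_0_iff)
    ultimately show ?thesis
      using card_TF by (simp add: m'_def)
  qed

  have "real (2 * d * m) \<le> real (m * (m - 1) + 2 * (card W + 1 + card F) * card S)"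
    using deg of_nat_le_iff by blast
  then have deg_real: "2 * real d * real m
      \<le> real m * (real m - 1) + 2 * (real (card W) + 1 + real (card F)) * real (card S)"
    \<comment> \<open>For \<open>m = 0\<close> the truncated \<open>m - 1\<close> has the factor 0,
      so it agrees with the real one in the product.\<close>
    by (cases m) (simp_all add: algebra_simps)
  have card_V': "real (card V) = 2 + real m + real (card Z) + real m' + real (card W)"
    using card_V by (simp add: m_def m'_def)
  have large': "2 * real (card V) + 3 \<le> 7 * real d"
    using large by linarith

  \<comment> \<open>Case distinction on the number of common vertices of \<open>A\<close> and
    \<open>B\<close>\<close>
  show False
  proof (cases "card Z + 2 \<le> d")
    case True
    then have "A1 \<noteq> {}" "B1 \<noteq> {}"
      using card_A card_B by auto
    then have "3 * d \<le> 2 * m + card Z" "3 * d + 2 * card F \<le> 2 * m' + card Z"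
      using A1_deg B1_deg card_A card_B by linarith+
    then have "3 * real d \<le> 2 * real m + real (card Z)"
        "3 * real d + 2 * real (card F) \<le> 2 * real m' + real (card Z)"
      by linarith+
    moreover have "real d \<le> real (card A1) + real (card Z) + 1" "real (card Z) + 2 \<le> real d"
      using card_A True by linarith+
    ultimately show False
      \<comment> \<open>\<open>a\<close> is instantiated with the lower bound
        \<open>d - 1 - card Z\<close> of \<open>card A1\<close>, not with \<open>card A1\<close>
        itself.\<close>
      by (intro few_common_contradiction[OF refl _ _ _ _ _ _ _ deg_real card_V' large'])
        (simp_all add: m_def)
  next
    case False
    \<comment> \<open>\<open>A1\<close> and \<open>B1\<close> may now be empty, so the bounds on
      \<open>m\<close> and \<open>m'\<close> come from the two degrees of a common vertex. It must
      differ from \<open>z\<close> to have no in-neighbour in \<open>F\<close>, which is possible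
      since \<open>d \<ge> 3\<close>.\<close>
    then have "2 \<le> card Z"
      using \<open>3 \<le> d\<close> by simp
    then have "\<not> Z \<subseteq> {z}"
      using card_mono[of "{z}" Z] by auto
    then obtain z' where z': "z' \<in> Z" "z' \<noteq> z"
      by blast
    have "{w. E z' w} \<subseteq> insert y (A1 \<union> S)" "{u. E u z'} \<subseteq> insert x (B1 \<union> (T - F))"
      using z' z AB unfolding A1_def B1_def S_def T_def Z_def by blast+
    then have "card {w. E z' w} \<le> card (insert y (A1 \<union> S))"
        "card {u. E u z'} \<le> card (insert x (B1 \<union> (T - F)))"
      using fins fins' by (auto intro!: card_mono)
    moreover have "card (insert y (A1 \<union> S)) \<le> m + 1"
      using fins fins' card_Un_le[of A1 S] by (simp add: m_def card_insert_if)
    moreover have "card (insert x (B1 \<union> (T - F))) + card F \<le> m' + 1"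
      using fins fins' card_Un_le[of B1 "T - F"] card_TF by (simp add: m'_def card_insert_if)
    ultimately have "d \<le> m + 1" "d + card F \<le> m' + 1"
      using out_deg[of z'] in_deg[of z'] z' sub by (auto simp: Z_def)
    then have "real d - 1 \<le> real m" "real d - 1 + real (card F) \<le> real m'"
        "real d - 1 \<le> real (card Z)"
      using False by linarith+
    then show False
      using \<open>3 \<le> d\<close>
      by (intro many_common_contradiction[OF _ _ _ _ _ _ _ deg_real card_V' large'])
        (simp_all add: m_def)
  qed
qed

section \<open>Transfer to the graph library\<close>

text \<open>Paths of the library are lists of arcs. The vertex list is kept in the conclusion
  because the induction step needs that the new first vertex does not recur.\<close>

lemma (in wf_digraph) apath_of_distinct_successively:
  assumes "successively (\<lambda>u v. u \<rightarrow> v) P" "distinct P" "P \<noteq> []" "last P \<in> verts G"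
  shows "\<exists>p. apath (hd P) p (last P) \<and> length p = length P - 1 \<and> awalk_verts (hd P) p = P"
  using assms
proof (induction P)
  case Nil
  then show ?case by simp
next
  case (Cons u P)
  show ?case
  proof (cases P)
    case Nil
    then show ?thesis
      using Cons.prems by (auto simp: apath_Nil_iff intro!: exI[of _ "[]"])
  next
    case (Cons v Q)
    with Cons.IH Cons.prems obtain p
      where p: "apath v p (last P)" "length p = length P - 1" "awalk_verts v p = P"
      by auto
    from Cons Cons.prems obtain e where "e \<in> arcs G" "tail G e = u" "head G e = v"
      by auto
    with p Cons Cons.prems show ?thesis
      by (auto simp: apath_Cons_iff intro!: exI[of _ "e # p"])
  qed
qed

text \<open>Without parallel arcs, \<open>head G\<close> is injective on the arcs leaving
  \<open>v\<close>.\<close>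

lemma (in digraph) out_degree_eq_card: "out_degree G v = card {w. v \<rightarrow> w}"
proof -
  have "{w. v \<rightarrow> w} = head G ` out_arcs G v"
    by (auto simp: arcs_ends_conv)
  moreover have "inj_on (head G) (out_arcs G v)"
    by (auto intro!: inj_onI no_multi_arcs simp: arc_to_ends_def)
  ultimately show ?thesis
    by (simp add: out_degree_def card_image)
qed

lemma (in digraph) in_degree_eq_card: "in_degree G v = card {u. u \<rightarrow> v}"
proof -
  have "{u. u \<rightarrow> v} = tail G ` in_arcs G v"
    by (auto simp: arcs_ends_conv)
  moreover have "inj_on (tail G) (in_arcs G v)"
    by (auto intro!: inj_onI no_multi_arcs simp: arc_to_ends_def)
  ultimately show ?thesis
    by (simp add: in_degree_def card_image)
qed

lemma (in fin_digraph) min_semidegree_le: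
  assumes "v \<in> verts G"
  shows "min_semidegree G \<le> out_degree G v" "min_semidegree G \<le> in_degree G v"
proof -
  have "min_semidegree G \<le> min (out_degree G v) (in_degree G v)"
    unfolding min_semidegree_def using assms by (intro Min_le) auto
  then show "min_semidegree G \<le> out_degree G v" "min_semidegree G \<le> in_degree G v"
    by auto
qed

theorem lemma2p2:
  fixes H :: "('a, 'b) pre_digraph" and N d :: nat
  assumes "oriented_graph H"
    and "N = card (verts H)"
    and "d = min_semidegree H"
    and "d \<ge> 3"
    and "7 * d \<ge> 2 * N + 3"
  shows "\<forall>x \<in> verts H. \<forall>y \<in> verts H. x \<noteq> y \<longrightarrow>
    (\<exists>p. pre_digraph.apath H x p y \<and> length p \<in> {3, 4, 5})"
proof (intro ballI impI)
  interpret oriented_graph H by fact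
  fix x y
  assume xy: "x \<in> verts H" "y \<in> verts H" "x \<noteq> y"
  have "\<exists>P. length P \<in> {4, 5, 6} \<and> distinct P \<and> hd P = x \<and> last P = y
      \<and> successively (\<lambda>u v. u \<rightarrow>\<^bsub>H\<^esub> v) P"
  proof (rule short_path_of_semidegree)
    show "d \<le> card {w. v \<rightarrow>\<^bsub>H\<^esub> w}" "d \<le> card {u. u \<rightarrow>\<^bsub>H\<^esub> v}" if "v \<in> verts H" for v
      using min_semidegree_le[OF that] assms(3) by (simp_all add: out_degree_eq_card in_degree_eq_card)
    show "2 * card (verts H) + 3 \<le> 7 * d"
      using assms by simp
  qed (use xy assms(4) no_opposite_arcs in \<open>auto intro: adj_in_verts\<close>)
  then obtain P where P: "length P \<in> {4, 5, 6}" "distinct P" "hd P = x" "last P = y"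
      "successively (\<lambda>u v. u \<rightarrow>\<^bsub>H\<^esub> v) P"
    by blast
  have "last P \<in> verts H" "P \<noteq> []"
    using P xy by auto
  then obtain p where "apath (hd P) p (last P)" "length p = length P - 1"
    using apath_of_distinct_successively[OF P(5,2)] by blast
  then show "\<exists>p. apath x p y \<and> length p \<in> {3, 4, 5}"
    using P by auto
qed

end
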